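(* Let $n$ be a positive odd integer, and for $k\geqslant 0$ let $$c_q(k)=\frac{2(q;q^2)_k^2\, q^{2k}}{(q^2;q^2)_k^2(1+q^{2k})}.$$ Then $$\sum_{k=0}^{n-1}\sum_{j=0}^{k}c_q(j)c_q(k-j)\equiv 1\pmod{\Phi_n(q)^2}.$$
   Context: Here $q$ is an indeterminate. The $q$-shifted factorial is $(x;q)_0=1$ and $(x;q)_m=(1-x)(1-xq)\cdots(1-xq^{m-1})$ for $m\geqslant1$. $\Phi_n(q)$ is the $n$-th cyclotomic polynomial. For rational functions $A,B$ in $q$ and a polynomial $P$, $A\equiv B\pmod{P}$ means that $A-B=P\cdot U/V$ for polynomials $U,V$ with $V$ coprime to $P$. *)

theory Defs
  imports
    Complex_Main
    "HOL-Computational_Algebra.Computational_Algebra"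
begin

definition qpochhammer :: "'a::comm_ring_1 \<Rightarrow> 'a \<Rightarrow> nat \<Rightarrow> 'a" where
  "qpochhammer x q m = (\<Prod>i<m. 1 - x * q ^ i)"

definition primitive_roots_of_unity :: "nat \<Rightarrow> complex set" where
  "primitive_roots_of_unity n = {z. z ^ n = 1 \<and> (\<forall>m. 0 < m \<and> m < n \<longrightarrow> z ^ m \<noteq> 1)}"

text \<open>The cyclotomic polynomial is the rational polynomial whose image over the complex numbers
  is the product of the linear factors at the primitive roots of unity. Lemma \<open>of_rat_cyclotomic\<close>
  below shows that it exists for every positive index; at index \<open>0\<close> the value is irrelevant.\<close>

definition cyclotomic :: "nat \<Rightarrow> rat poly" where
  "cyclotomic n =
     (THE p. map_poly of_rat p = (\<Prod>z\<in>primitive_roots_of_unity n. [:- z, 1:]))"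

definition ratfun_cong :: "rat poly fract \<Rightarrow> rat poly fract \<Rightarrow> rat poly \<Rightarrow> bool" where
  "ratfun_cong A B P \<longleftrightarrow>
     (\<exists>U V. V \<noteq> 0 \<and> coprime V P \<and> A - B = to_fract P * (to_fract U / to_fract V))"

definition q_indet :: "rat poly fract" where
  "q_indet = to_fract [:0, 1:]"

definition c_q :: "'a::field \<Rightarrow> nat \<Rightarrow> 'a" where
  "c_q q k = 2 * (qpochhammer q (q\<^sup>2) k)\<^sup>2 * q ^ (2 * k)
               / ((qpochhammer (q\<^sup>2) (q\<^sup>2) k)\<^sup>2 * (1 + q ^ (2 * k)))"

abbreviation c_poly :: "rat poly \<Rightarrow> complex poly" where
  "c_poly \<equiv> map_poly of_rat"

lemma c_poly_1: "c_poly 1 = 1"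
  by (intro poly_eqI) (simp add: coeff_map_poly)

lemma c_poly_add: "c_poly (p + q) = c_poly p + c_poly q"
  by (intro poly_eqI) (simp add: coeff_map_poly of_rat_add)

lemma c_poly_diff: "c_poly (p - q) = c_poly p - c_poly q"
  by (intro poly_eqI) (simp add: coeff_map_poly of_rat_diff)

lemma c_poly_mult: "c_poly (p * q) = c_poly p * c_poly q"
  by (intro poly_eqI) (simp add: coeff_map_poly coeff_mult of_rat_sum of_rat_mult)

lemma c_poly_prod: "c_poly (prod f A) = (\<Prod>x\<in>A. c_poly (f x))"
  by (induction A rule: infinite_finite_induct) (simp_all add: c_poly_1 c_poly_mult)

lemma c_poly_inj: "c_poly p = c_poly q \<Longrightarrow> p = q"
  by (auto simp: poly_eq_iff coeff_map_poly)

lemma degree_c_poly: "degree (c_poly p) = degree p"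
  by (rule degree_map_poly) simp

lemma roots_of_unity_split:
  assumes "n > 0"
  shows "{z::complex. z ^ n = 1} = (\<Union>d\<in>{d. d dvd n}. primitive_roots_of_unity d)"
proof (intro equalityI subsetI)
  fix z :: complex assume z: "z \<in> {z. z ^ n = 1}"
  define d where "d = (LEAST d. d > 0 \<and> z ^ d = 1)"
  have d: "d > 0 \<and> z ^ d = 1"
    unfolding d_def by (rule LeastI[of _ n]) (use z assms in auto)
  have min: "z ^ m \<noteq> 1" if "0 < m" "m < d" for m
    using not_less_Least[of m "\<lambda>d. d > 0 \<and> z ^ d = 1"] that by (auto simp: d_def)
  have "z ^ n = z ^ (d * (n div d) + n mod d)" by simp
  also have "\<dots> = z ^ (n mod d)"
    using d by (simp only: power_add power_mult) simp
  finally have "z ^ (n mod d) = 1" using z by simp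
  hence "n mod d = 0" using min[of "n mod d"] d by auto
  hence "d dvd n" by auto
  thus "z \<in> (\<Union>d\<in>{d. d dvd n}. primitive_roots_of_unity d)"
    using d min by (auto simp: primitive_roots_of_unity_def)
next
  fix z :: complex assume "z \<in> (\<Union>d\<in>{d. d dvd n}. primitive_roots_of_unity d)"
  thus "z \<in> {z. z ^ n = 1}"
    by (auto simp: primitive_roots_of_unity_def elim!: dvdE simp: power_mult)
qed

lemma primitive_roots_of_unity_disjoint:
  assumes "d > 0" "e > 0" "d \<noteq> e"
  shows "primitive_roots_of_unity d \<inter> primitive_roots_of_unity e = {}"
  using assms by (auto simp: primitive_roots_of_unity_def) (metis linorder_neqE_nat)

lemma finite_primitive_roots_of_unity: "n > 0 \<Longrightarrow> finite (primitive_roots_of_unity n)"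
  by (rule finite_subset[OF _ finite_roots_unity[of n]]) (auto simp: primitive_roots_of_unity_def)

lemma prod_roots_of_unity:
  assumes "n > 0"
  shows "(\<Prod>z | z ^ n = 1. [:- z, 1:]) = monom (1::complex) n - 1"
proof -
  let ?p = "monom (1::complex) n - 1"
  have lead: "lead_coeff ?p = 1"
  proof -
    have "degree ?p = n"
      using assms degree_add_eq_left[of "- 1 :: complex poly" "monom 1 n"]
      by (simp add: degree_monom_eq)
    thus ?thesis using assms by simp
  qed
  have "rsquarefree ?p"
    unfolding rsquarefree_roots
  proof (intro allI notI)
    fix a assume a: "poly ?p a = 0 \<and> poly (pderiv ?p) a = 0"
    hence "a ^ n = 1" by (simp add: poly_monom)
    moreover have "of_nat n * a ^ (n - 1) = 0"
      using a by (simp add: pderiv_diff pderiv_monom poly_monom)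
    ultimately show False using assms by (auto simp: power_0_left)
  qed
  from complex_poly_decompose_rsquarefree[OF this] lead show ?thesis
    by (simp add: poly_monom)
qed

lemma prod_primitive_roots_of_unity:
  assumes "n > 0"
  shows "(\<Prod>d | d dvd n. \<Prod>z\<in>primitive_roots_of_unity d. [:- z, 1:]) = monom (1::complex) n - 1"
proof -
  have "(\<Prod>z\<in>(\<Union>d\<in>{d. d dvd n}. primitive_roots_of_unity d). [:- z, 1:])
      = (\<Prod>d | d dvd n. \<Prod>z\<in>primitive_roots_of_unity d. [:- z, 1:])"
  proof (intro prod.UNION_disjoint ballI impI)
    fix d e assume "d \<in> {d. d dvd n}" "e \<in> {d. d dvd n}" "d \<noteq> e"
    thus "primitive_roots_of_unity d \<inter> primitive_roots_of_unity e = {}"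
      using assms by (intro primitive_roots_of_unity_disjoint) (auto intro: dvd_pos_nat)
  qed (use assms in \<open>auto intro: finite_primitive_roots_of_unity dvd_pos_nat\<close>)
  thus ?thesis
    using prod_roots_of_unity[OF assms] roots_of_unity_split[OF assms] by simp
qed

lemma cyclotomic_exists:
  assumes "n > 0"
  shows "\<exists>p. c_poly p = (\<Prod>z\<in>primitive_roots_of_unity n. [:- z, 1:])"
  using assms
proof (induction n rule: less_induct)
  case (less n)
  let ?\<Psi> = "\<lambda>d. \<Prod>z\<in>primitive_roots_of_unity d. [:- z, 1:]"
  let ?D = "{d. d dvd n \<and> d < n}"
  have "\<forall>d\<in>?D. \<exists>p. c_poly p = ?\<Psi> d"
    using less by (auto intro: dvd_pos_nat)
  then obtain f where f: "\<And>d. d \<in> ?D \<Longrightarrow> c_poly (f d) = ?\<Psi> d" by metis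
  define Q where "Q = prod f ?D"
  define p where "p = monom (1::rat) n - 1"
  have Q: "c_poly Q = prod ?\<Psi> ?D" using f by (simp add: Q_def c_poly_prod)
  have "prod ?\<Psi> ?D \<noteq> 0"
    using less.prems
    by (auto simp: prod_zero_iff finite_primitive_roots_of_unity dvd_pos_nat)
  hence Q0: "c_poly Q \<noteq> 0" "Q \<noteq> 0" using Q by auto
  have "{d. d dvd n} = insert n ?D" using less.prems by (auto dest: dvd_imp_le)
  hence "?\<Psi> n * c_poly Q = monom 1 n - 1"
    using prod_primitive_roots_of_unity[OF less.prems] Q by simp
  also have "\<dots> = c_poly p"
    by (simp add: p_def c_poly_diff c_poly_1 map_poly_monom)
  also have "p = p div Q * Q + p mod Q" by simp
  also have "c_poly \<dots> = c_poly (p div Q) * c_poly Q + c_poly (p mod Q)"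
    by (simp only: c_poly_add c_poly_mult)
  finally have eq: "(?\<Psi> n - c_poly (p div Q)) * c_poly Q = c_poly (p mod Q)"
    by (simp add: algebra_simps)
  have "?\<Psi> n - c_poly (p div Q) = 0"
  proof (rule ccontr)
    assume ne: "?\<Psi> n - c_poly (p div Q) \<noteq> 0"
    hence "c_poly (p mod Q) \<noteq> 0" using eq Q0 by (metis mult_eq_0_iff)
    hence "p mod Q \<noteq> 0" by auto
    hence "degree (p mod Q) < degree Q" using degree_mod_less[OF Q0(2)] by blast
    moreover have "degree (c_poly (p mod Q)) \<ge> degree (c_poly Q)"
      unfolding eq[symmetric] using ne Q0 by (simp add: degree_mult_eq)
    ultimately show False by (simp add: degree_c_poly)
  qed
  thus ?case by (metis eq_iff_diff_eq_0)
qed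

lemma of_rat_cyclotomic:
  assumes "n > 0"
  shows "map_poly of_rat (cyclotomic n) = (\<Prod>z\<in>primitive_roots_of_unity n. [:- z, 1:])"
proof -
  have "\<exists>!p. c_poly p = (\<Prod>z\<in>primitive_roots_of_unity n. [:- z, 1:])"
    using cyclotomic_exists[OF assms] c_poly_inj by metis
  from theI'[OF this] show ?thesis unfolding cyclotomic_def .
qed

end

theory Submission
  imports Defs "HOL-Computational_Algebra.Field_as_Ring"
begin

text \<open>Write \<open>n = 2m + 1\<close> and \<open>Q = q\<^sup>2\<close>. Modulo the square of the cyclotomic polynomial,
  \<open>(q;Q)\<^sub>k\<^sup>2\<close> may be replaced by \<open>(q\<^bsup>1-n\<^esup>;Q)\<^sub>k (q\<^bsup>1+n\<^esup>;Q)\<^sub>k = (Q\<^bsup>-m\<^esup>;Q)\<^sub>k (Q\<^bsup>m+1\<^esup>;Q)\<^sub>k\<close>,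
  which vanishes for \<open>k > m\<close>. Hence the truncated convolution becomes the full square of a
  terminating sum, and that sum is \<open>(-1)\<^sup>m\<close> by an instance of the q-Saalschuetz formula. The
  instance follows by induction on \<open>m\<close>: the sum of the summands for \<open>m\<close> and \<open>m + 1\<close> is twice the
  summand of a telescoping q-Chu-Vandermonde sum with value \<open>0\<close>.\<close>

section \<open>Shifted factorials\<close>

lemma qpochhammer_0 [simp]: "qpochhammer x q 0 = 1"
  by (simp add: qpochhammer_def)

lemma qpochhammer_Suc: "qpochhammer x q (Suc k) = qpochhammer x q k * (1 - x * q ^ k)"
  by (simp add: qpochhammer_def)

lemma qpochhammer_Suc_shift:
  "qpochhammer x q (Suc k) = (1 - x) * qpochhammer (x * q) q k"
  by (simp add: qpochhammer_def prod.lessThan_Suc_shift mult.assoc del: prod.lessThan_Suc)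

text \<open>Both sides are the product with \<open>Suc k\<close> factors, split off at either end.
  This form compares base points \<open>x\<close> and \<open>x * q\<close> without dividing by
  \<open>1 - x\<close>.\<close>

lemma qpochhammer_shift_eq:
  "(1 - x) * qpochhammer (x * q) q k = qpochhammer x q k * (1 - x * q ^ k)"
  by (metis qpochhammer_Suc qpochhammer_Suc_shift)

lemma qpochhammer_eq_0:
  assumes "i < k" "x * q ^ i = 1"
  shows "qpochhammer x q k = 0"
  unfolding qpochhammer_def using assms by (intro prod_zero) auto

lemma qpochhammer_nonzero:
  fixes q :: "'a::field"
  assumes "\<And>k. q ^ Suc k \<noteq> 1"
  shows "qpochhammer q q k \<noteq> 0"
  using assms by (simp add: qpochhammer_def)

section \<open>Two basic hypergeometric summations\<close>

text \<open>Adding one more summand to the closed form reduces to \<open>(1 - x)^2 + (1 - a) * (1 -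
  b) * x = (1 - a * x) * (1 - b * x)\<close> with \<open>x = q ^ Suc K\<close>, an identity that
  rests on \<open>a * b = 1\<close>.\<close>

lemma sum_qpochhammer_telescope:
  fixes q a b :: "'a::field"
  assumes ab: "a * b = 1" and q: "\<And>k. q ^ Suc k \<noteq> 1"
  shows "(\<Sum>k\<le>K. qpochhammer a q k * qpochhammer b q k / (qpochhammer q q k)\<^sup>2 * q ^ k)
       = qpochhammer (a * q) q K * qpochhammer (b * q) q K / (qpochhammer q q K)\<^sup>2"
proof (induction K)
  case (Suc K)
  define x where "x = q ^ Suc K"
  define A where "A = qpochhammer (a * q) q K"
  define B where "B = qpochhammer (b * q) q K"
  define C where "C = qpochhammer q q K"
  have C: "C \<noteq> 0" "1 - x \<noteq> 0"
    using qpochhammer_nonzero[OF q] q by (auto simp: C_def x_def)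
  have id: "(1 - x)\<^sup>2 + (1 - a) * (1 - b) * x = (1 - a * x) * (1 - b * x)"
    using ab by algebra
  have C': "qpochhammer q q (Suc K) = C * (1 - x)"
    by (simp add: qpochhammer_Suc C_def x_def)
  have "A * B / C\<^sup>2 + ((1 - a) * A) * ((1 - b) * B) / (C * (1 - x))\<^sup>2 * x
      = A * B * ((1 - x)\<^sup>2 + (1 - a) * (1 - b) * x) / (C * (1 - x))\<^sup>2"
    using C by (simp add: divide_simps power_mult_distrib) (simp add: algebra_simps)
  also have "\<dots> = (A * (1 - a * x)) * (B * (1 - b * x)) / (C * (1 - x))\<^sup>2"
    unfolding id by (simp add: mult_ac)
  finally show ?case
    using Suc.IH
    by (simp only: sum.atMost_Suc C' qpochhammer_Suc_shift[of a] qpochhammer_Suc_shift[of b]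
        qpochhammer_Suc[of "a * q"] qpochhammer_Suc[of "b * q"]
        A_def[symmetric] B_def[symmetric] C_def[symmetric] x_def[symmetric] power_Suc mult.assoc)
       (simp add: x_def mult_ac)
qed simp

text \<open>Since \<open>2 / (1 + q^k)\<close> is the quotient of the shifted factorials of -1 and
  \<open>-q\<close>, this is a balanced 3-phi-2 series with upper parameters \<open>q^(-m)\<close>,
  \<open>q^(m+1)\<close>, -1 and lower parameters \<open>q\<close>, \<open>-q\<close>.\<close>

lemma sum_qpochhammer_saalschuetz:
  fixes q :: "'a::field"
  assumes q0: "q \<noteq> 0" and q: "\<And>k. q ^ Suc k \<noteq> 1" and q': "\<And>k. 1 + q ^ k \<noteq> 0"
  shows "(\<Sum>k\<le>m. 2 * (qpochhammer (inverse (q ^ m)) q k * qpochhammer (q ^ Suc m) q k) * q ^ k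
            / ((qpochhammer q q k)\<^sup>2 * (1 + q ^ k))) = (-1) ^ m"
proof (induction m)
  case 0
  \<comment> \<open>At exponent 0 the hypothesis \<open>q'\<close> says that 2 is nonzero, so the
    only summand is 2/2.\<close>
  show ?case using q'[of 0] by simp
next
  case (Suc m)
  define M where "M = Suc m"
  define T where "T = (\<lambda>m k. 2 * (qpochhammer (inverse (q ^ m)) q k * qpochhammer (q ^ Suc m) q k)
    * q ^ k / ((qpochhammer q q k)\<^sup>2 * (1 + q ^ k)))"
  define U where "U = (\<lambda>k. qpochhammer (inverse (q ^ M)) q k * qpochhammer (q ^ M) q k
    / (qpochhammer q q k)\<^sup>2 * q ^ k)"
  have TU: "T M k + T m k = 2 * U k" for k
  proof -
    define A where "A = qpochhammer (inverse (q ^ M)) q k"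
    define A' where "A' = qpochhammer (inverse (q ^ m)) q k"
    define B where "B = qpochhammer (q ^ M) q k"
    define B' where "B' = qpochhammer (q ^ Suc M) q k"
    define C where "C = qpochhammer q q k"
    define y where "y = q ^ M"
    define x where "x = q ^ k"
    have y: "y \<noteq> 0" "y \<noteq> 1" using q0 q[of m] by (auto simp: y_def M_def)
    have "inverse (q ^ M) * q = inverse (q ^ m)" using q0 by (simp add: M_def)
    hence 1: "(1 - inverse y) * A' = A * (1 - inverse y * x)"
      using qpochhammer_shift_eq[of "inverse (q ^ M)" q k]
      by (simp add: A_def A'_def y_def x_def)
    have 2: "(1 - y) * B' = B * (1 - y * x)"
      using qpochhammer_shift_eq[of "q ^ M" q k]
      by (simp add: B_def B'_def y_def x_def mult_ac)
    have 1: "(y - 1) * A' = A * (y - x)"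
    proof -
      have "y * (1 - inverse y) = y - 1" "y * (1 - inverse y * x) = y - x"
        using y by (simp_all add: right_diff_distrib flip: mult.assoc)
      thus ?thesis using 1 by (metis mult.assoc mult.left_commute)
    qed
    \<comment> \<open>The two shift relations contribute \<open>y * x - 1\<close> and
      \<open>y - x\<close>, whose sum is \<open>(y - 1) * (1 + x)\<close>. The factor
      \<open>1 + x\<close> then cancels the denominator that separates \<open>T\<close> from
      \<open>U\<close>.\<close>
    have "(y - 1) * (A * B' + A' * B) = (y - 1) * (A * B * (1 + x))"
      using 1 2 by algebra
    hence AB: "A * B' + A' * B = A * B * (1 + x)" using y by simp
    have "T M k + T m k = 2 * (A * B' + A' * B) * x / (C\<^sup>2 * (1 + x))"
      by (simp only: T_def A_def A'_def B_def B'_def C_def x_def M_def add_divide_distrib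
          distrib_left distrib_right)
    also have "\<dots> = 2 * (A * B / C\<^sup>2 * x)"
      unfolding AB using q'[of k] by (simp add: x_def[symmetric])
    also have "\<dots> = 2 * U k" by (simp only: A_def B_def C_def x_def U_def)
    finally show ?thesis .
  qed
  have "(\<Sum>k\<le>M. U k) = qpochhammer (inverse (q ^ M) * q) q M * qpochhammer (q ^ M * q) q M
      / (qpochhammer q q M)\<^sup>2"
    unfolding U_def by (rule sum_qpochhammer_telescope) (use q0 q in auto)
  \<comment> \<open>The last factor, at index \<open>m\<close>, contains
    \<open>q^(-M) * q * q^m = 1\<close>.\<close>
  also have "qpochhammer (inverse (q ^ M) * q) q M = 0"
    by (rule qpochhammer_eq_0[of m]) (use q0 in \<open>simp_all add: M_def field_simps\<close>)
  finally have "(\<Sum>k\<le>M. U k) = 0" by simp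
  hence "(\<Sum>k\<le>M. T M k) + (\<Sum>k\<le>M. T m k) = 0"
    by (simp add: sum.distrib[symmetric] TU sum_distrib_left[symmetric])
  \<comment> \<open>The summand for \<open>m\<close> vanishes at the extra index \<open>M\<close>,
    so the induction hypothesis also covers the range up to \<open>M\<close>.\<close>
  moreover have "T m M = 0"
    using qpochhammer_eq_0[of m M "inverse (q ^ m)" q] q0 by (simp add: T_def M_def)
  hence "(\<Sum>k\<le>M. T m k) = (-1) ^ m"
    using Suc.IH by (simp add: M_def T_def)
  ultimately have "(\<Sum>k\<le>M. T M k) = - ((-1) ^ m)" by (simp add: eq_neg_iff_add_eq_0)
  thus ?case by (simp only: T_def M_def power_Suc mult_minus1)
qed

section \<open>Congruences in a localized polynomial ring\<close>

text \<open>The localization of the polynomial ring at the denominators coprime to \<open>P\<close>,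
  taken inside the field of fractions. Congruence modulo \<open>P\<close> means that the difference
  lies in the ideal generated by \<open>P\<close> in this ring.\<close>

definition coprime_fracs :: "rat poly \<Rightarrow> rat poly fract set" where
  "coprime_fracs P = {to_fract U / to_fract V |U V. V \<noteq> 0 \<and> coprime V P}"

lemma ratfun_cong_altdef:
  "ratfun_cong A B P \<longleftrightarrow> (\<exists>r\<in>coprime_fracs P. A - B = to_fract P * r)"
  unfolding ratfun_cong_def coprime_fracs_def by blast

lemma coprime_fracsI:
  "V \<noteq> 0 \<Longrightarrow> coprime V P \<Longrightarrow> to_fract U / to_fract V \<in> coprime_fracs P"
  unfolding coprime_fracs_def by blast

lemma coprime_fracsE:
  assumes "a \<in> coprime_fracs P"
  obtains U V where "V \<noteq> 0" "coprime V P" "a = to_fract U / to_fract V"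
  using assms unfolding coprime_fracs_def by blast

lemma coprime_fracs_to_fract [intro]: "to_fract U \<in> coprime_fracs P"
  using coprime_fracsI[of 1 P U] by simp

lemma coprime_fracs_0 [intro]: "0 \<in> coprime_fracs P"
  using coprime_fracs_to_fract[of 0] by simp

lemma coprime_fracs_1 [intro]: "1 \<in> coprime_fracs P"
  using coprime_fracs_to_fract[of 1] by simp

lemma coprime_fracs_inverse_to_fract:
  assumes "V \<noteq> 0" "coprime V P"
  shows "inverse (to_fract V) \<in> coprime_fracs P"
  using coprime_fracsI[OF assms, of 1] by (simp add: inverse_eq_divide)

lemma coprime_fracs_mult [intro]:
  assumes "a \<in> coprime_fracs P" "b \<in> coprime_fracs P"
  shows "a * b \<in> coprime_fracs P"
proof -
  from assms obtain U V U' V' where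
    "V \<noteq> 0" "coprime V P" "a = to_fract U / to_fract V"
    "V' \<noteq> 0" "coprime V' P" "b = to_fract U' / to_fract V'"
    by (metis coprime_fracsE)
  thus ?thesis using coprime_fracsI[of "V * V'" P "U * U'"] by simp
qed

lemma coprime_fracs_add [intro]:
  assumes "a \<in> coprime_fracs P" "b \<in> coprime_fracs P"
  shows "a + b \<in> coprime_fracs P"
proof -
  from assms obtain U V U' V' where
    "V \<noteq> 0" "coprime V P" "a = to_fract U / to_fract V"
    "V' \<noteq> 0" "coprime V' P" "b = to_fract U' / to_fract V'"
    by (metis coprime_fracsE)
  thus ?thesis using coprime_fracsI[of "V * V'" P "U * V' + U' * V"] by (simp add: add_frac_eq)
qed

lemma coprime_fracs_uminus [intro]: "a \<in> coprime_fracs P \<Longrightarrow> - a \<in> coprime_fracs P"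
  using coprime_fracs_mult[OF coprime_fracs_to_fract[of "-1"]] by simp

lemma coprime_fracs_diff [intro]:
  "a \<in> coprime_fracs P \<Longrightarrow> b \<in> coprime_fracs P \<Longrightarrow> a - b \<in> coprime_fracs P"
  using coprime_fracs_add[of a P "- b"] by auto

lemma coprime_fracs_power [intro]: "a \<in> coprime_fracs P \<Longrightarrow> a ^ k \<in> coprime_fracs P"
  by (induction k) auto

lemma coprime_fracs_prod [intro]:
  "(\<And>i. i \<in> I \<Longrightarrow> f i \<in> coprime_fracs P) \<Longrightarrow> prod f I \<in> coprime_fracs P"
  by (induction I rule: infinite_finite_induct) auto

text \<open>Coprimality to \<open>P^2\<close> and to \<open>P\<close> coincide, so invertibility
  modulo the squared cyclotomic polynomial can be checked at its roots.\<close>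

lemma coprime_fracs_power2 [simp]: "coprime_fracs (P\<^sup>2) = coprime_fracs P"
  by (simp add: coprime_fracs_def)

lemma ratfun_cong_refl [intro]: "ratfun_cong A A P"
  by (auto simp: ratfun_cong_altdef intro!: bexI[of _ 0])

lemma ratfun_cong_add:
  assumes "ratfun_cong A B P" "ratfun_cong C D P"
  shows "ratfun_cong (A + C) (B + D) P"
proof -
  from assms obtain r s where rs: "r \<in> coprime_fracs P" "A - B = to_fract P * r"
    "s \<in> coprime_fracs P" "C - D = to_fract P * s"
    by (auto simp: ratfun_cong_altdef)
  have "(A + C) - (B + D) = to_fract P * (r + s)"
    using rs by (simp add: algebra_simps)
  thus ?thesis using rs by (auto simp: ratfun_cong_altdef)
qed

lemma ratfun_cong_sum:
  assumes "\<And>i. i \<in> I \<Longrightarrow> ratfun_cong (f i) (g i) P"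
  shows "ratfun_cong (sum f I) (sum g I) P"
  using assms by (induction I rule: infinite_finite_induct) (auto intro: ratfun_cong_add)

text \<open>In the splitting \<open>A * C - B * D = (A - B) * C + B * (C - D)\<close> the cofactors
  are \<open>C\<close> and \<open>B\<close>, hence the two membership conditions.\<close>

lemma ratfun_cong_mult:
  assumes "ratfun_cong A B P" "ratfun_cong C D P" "B \<in> coprime_fracs P" "C \<in> coprime_fracs P"
  shows "ratfun_cong (A * C) (B * D) P"
proof -
  from assms obtain r s where rs: "r \<in> coprime_fracs P" "A - B = to_fract P * r"
    "s \<in> coprime_fracs P" "C - D = to_fract P * s"
    by (auto simp: ratfun_cong_altdef)
  have "A * C - B * D = (A - B) * C + B * (C - D)" by (simp add: algebra_simps)
  also have "\<dots> = to_fract P * (r * C + B * s)"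
    unfolding rs by (simp add: algebra_simps)
  finally show ?thesis using rs assms by (auto simp: ratfun_cong_altdef)
qed

lemma ratfun_cong_prod:
  assumes "\<And>i. i \<in> I \<Longrightarrow> ratfun_cong (f i) (g i) P"
    and "\<And>i. i \<in> I \<Longrightarrow> f i \<in> coprime_fracs P" "\<And>i. i \<in> I \<Longrightarrow> g i \<in> coprime_fracs P"
  shows "ratfun_cong (prod f I) (prod g I) P"
  using assms by (induction I rule: infinite_finite_induct) (auto intro!: ratfun_cong_mult)

section \<open>Cyclotomic polynomials and powers of the indeterminate\<close>

text \<open>A complex root of a common divisor would be a primitive root of unity at which
  \<open>V\<close> vanishes. A common divisor therefore has no complex root and is constant by the
  fundamental theorem of algebra.\<close>

lemma coprime_cyclotomic:
  assumes "n > 0" "\<And>z. z \<in> primitive_roots_of_unity n \<Longrightarrow> poly (c_poly V) z \<noteq> 0"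
  shows "coprime V (cyclotomic n)"
proof (rule coprimeI)
  fix g assume g: "g dvd V" "g dvd cyclotomic n"
  have no_root: "poly (c_poly g) z \<noteq> 0" for z
  proof
    assume z: "poly (c_poly g) z = 0"
    from g obtain a b where "V = g * a" "cyclotomic n = g * b" by (auto elim!: dvdE)
    hence "poly (c_poly V) z = 0" "poly (c_poly (cyclotomic n)) z = 0"
      using z by (simp_all add: c_poly_mult)
    moreover from this have "z \<in> primitive_roots_of_unity n"
      using assms(1)
      by (auto simp: of_rat_cyclotomic poly_prod finite_primitive_roots_of_unity)
    ultimately show False using assms(2) by blast
  qed
  hence "constant (poly (c_poly g))"
    using fundamental_theorem_of_algebra by blast
  hence "degree g = 0"
    using constant_degree[of "c_poly g"] by (simp add: degree_c_poly)
  moreover have "g \<noteq> 0" using no_root[of 0] by auto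
  ultimately show "is_unit g" by (simp add: is_unit_iff_degree)
qed

text \<open>The complex factorization over the divisors of \<open>n\<close> descends to the
  rationals because \<open>c_poly\<close> is injective. The result makes \<open>q^n\<close>
  congruent to 1.\<close>

lemma cyclotomic_dvd:
  assumes "n > 0"
  shows "cyclotomic n dvd monom 1 n - 1"
proof -
  have "c_poly (monom 1 n - 1) = (\<Prod>d | d dvd n. c_poly (cyclotomic d))"
    using prod_primitive_roots_of_unity[OF assms] assms
    by (simp add: c_poly_diff c_poly_1 map_poly_monom of_rat_cyclotomic dvd_pos_nat)
  hence "monom 1 n - 1 = (\<Prod>d | d dvd n. cyclotomic d)"
    by (intro c_poly_inj) (simp add: c_poly_prod)
  thus ?thesis using assms by (auto intro: dvd_prodI)
qed

lemma q_indet_power: "q_indet ^ k = to_fract (monom 1 k)"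
  by (induction k) (simp_all add: q_indet_def monom_Suc flip: to_fract_mult)

lemma q_indet_nonzero: "q_indet \<noteq> 0"
  by (simp add: q_indet_def)

lemma q_indet_power_neq_1:
  assumes "k > 0"
  shows "q_indet ^ k \<noteq> 1"
proof
  assume "q_indet ^ k = 1"
  hence "monom 1 k = (1 :: rat poly)"
    unfolding q_indet_power to_fract_1[symmetric] to_fract_eq_iff .
  hence "degree (monom 1 k :: rat poly) = degree (1 :: rat poly)" by (rule arg_cong)
  thus False using assms by (simp add: degree_monom_eq)
qed

lemma one_plus_q_indet_power_nonzero: "1 + q_indet ^ k \<noteq> 0"
proof
  assume "1 + q_indet ^ k = 0"
  hence "1 + monom 1 k = (0 :: rat poly)"
    unfolding q_indet_power to_fract_1[symmetric] to_fract_add[symmetric] to_fract_eq_0_iff .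
  hence "poly (1 + monom 1 k) 1 = (0 :: rat)" by simp
  thus False by (simp add: poly_monom)
qed

text \<open>The triangle \<open>i + j \<le> 2 * m\<close> contains the square of side
  \<open>m\<close>, and outside that square at least one factor vanishes.\<close>

lemma sum_convolution_square:
  fixes d :: "nat \<Rightarrow> 'a::comm_ring_1"
  assumes d: "\<And>j. j > m \<Longrightarrow> d j = 0"
  shows "(\<Sum>k\<le>2*m. \<Sum>j\<le>k. d j * d (k - j)) = (\<Sum>j\<le>m. d j)\<^sup>2"
proof -
  have "(\<Sum>k\<le>2*m. \<Sum>j\<le>k. d j * d (k - j)) = (\<Sum>(i,j) | i + j \<le> 2*m. d i * d j)"
    by (rule sum.triangle_reindex_eq[symmetric])
  also have "\<dots> = (\<Sum>(i,j)\<in>{..m} \<times> {..m}. d i * d j)"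
  proof (rule sum.mono_neutral_right)
    show "finite {(i, j). i + j \<le> 2 * m}"
      by (rule finite_subset[of _ "{..2*m} \<times> {..2*m}"]) auto
    show "\<forall>x\<in>{(i, j). i + j \<le> 2 * m} - {..m} \<times> {..m}. (case x of (i, j) \<Rightarrow> d i * d j) = 0"
      using d by (auto simp del: mult_eq_0_iff) (metis mult_zero_left mult_zero_right not_le)+
    show "{..m} \<times> {..m} \<subseteq> {(i, j). i + j \<le> 2 * m}" by auto
  qed
  also have "\<dots> = (\<Sum>j\<le>m. d j)\<^sup>2"
    by (simp add: power2_eq_square sum_product sum.cartesian_product)
  finally show ?thesis .
qed

section \<open>Denominators invertible modulo the cyclotomic polynomial\<close>

text \<open>The exponent \<open>2 * j\<close> lies strictly between 0 and \<open>2 * n\<close> and,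
  by parity, differs from \<open>n\<close>. Subtracting \<open>n\<close> at most once leaves an
  exponent to which the minimality of \<open>n\<close> applies.\<close>

lemma primitive_root_power_neq_1:
  assumes z: "z \<in> primitive_roots_of_unity n" and "odd n" "0 < j" "j < n"
  shows "z ^ (2 * j) \<noteq> 1"
proof
  assume 1: "z ^ (2 * j) = 1"
  have zn: "z ^ n = 1" and min: "\<And>m. 0 < m \<Longrightarrow> m < n \<Longrightarrow> z ^ m \<noteq> 1"
    using z by (auto simp: primitive_roots_of_unity_def)
  show False
  proof (cases "2 * j < n")
    case True
    thus ?thesis using min[of "2 * j"] 1 assms by simp
  next
    case False
    hence "2 * j = n + (2 * j - n)" by simp
    hence "z ^ (2 * j - n) = 1" using 1 zn by (metis mult_1 power_add)
    moreover have "2 * j \<noteq> n" using \<open>odd n\<close> by auto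
    ultimately show ?thesis using min[of "2 * j - n"] False assms by simp
  qed
qed

text \<open>If \<open>z ^ j\<close> were -1, its odd power with exponent \<open>n\<close> would
  again be -1, while \<open>z ^ n = 1\<close> forces 1.\<close>

lemma primitive_root_power_neq_minus_1:
  assumes z: "z \<in> primitive_roots_of_unity n" and "odd n"
  shows "1 + z ^ j \<noteq> 0"
proof
  assume "1 + z ^ j = 0"
  hence "z ^ j = -1" by (simp add: eq_neg_iff_add_eq_0 add.commute)
  hence "(z ^ j) ^ n = -1" using \<open>odd n\<close> by simp
  moreover have "(z ^ j) ^ n = (z ^ n) ^ j" by (simp add: mult.commute flip: power_mult)
  ultimately show False using z by (auto simp: primitive_roots_of_unity_def)
qed

lemma inverse_q_indet_in_coprime_fracs:
  assumes "n > 0"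
  shows "inverse q_indet \<in> coprime_fracs (cyclotomic n)"
  unfolding q_indet_def
proof (rule coprime_fracs_inverse_to_fract)
  show "coprime [:0, 1:] (cyclotomic n)"
    using assms by (intro coprime_cyclotomic)
      (auto simp: map_poly_pCons primitive_roots_of_unity_def power_0_left)
qed simp

text \<open>Handles the factors of \<open>qpochhammer Q Q k\<close> with \<open>Q = q^2\<close> and
  \<open>k < n\<close>, whose indices \<open>j\<close> run from 1 to \<open>k\<close>.\<close>

lemma inverse_one_minus_in_coprime_fracs:
  assumes "odd n" "0 < j" "j < n"
  shows "inverse (1 - q_indet ^ (2 * j)) \<in> coprime_fracs (cyclotomic n)"
proof -
  let ?V = "1 - monom 1 (2 * j) :: rat poly"
  have V: "to_fract ?V = 1 - q_indet ^ (2 * j)" by (simp add: q_indet_power)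
  show ?thesis unfolding V[symmetric]
  proof (rule coprime_fracs_inverse_to_fract)
    show "?V \<noteq> 0" using q_indet_power_neq_1[of "2 * j"] assms V by force
    show "coprime ?V (cyclotomic n)"
      using assms primitive_root_power_neq_1[of _ n j] by (intro coprime_cyclotomic)
        (auto simp: c_poly_diff c_poly_1 map_poly_monom poly_monom)
  qed
qed

lemma inverse_one_plus_in_coprime_fracs:
  assumes "odd n"
  shows "inverse (1 + q_indet ^ j) \<in> coprime_fracs (cyclotomic n)"
proof -
  let ?V = "1 + monom 1 j :: rat poly"
  have V: "to_fract ?V = 1 + q_indet ^ j" by (simp add: q_indet_power)
  show ?thesis unfolding V[symmetric]
  proof (rule coprime_fracs_inverse_to_fract)
    show "?V \<noteq> 0" using one_plus_q_indet_power_nonzero[of j] V by force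
    show "coprime ?V (cyclotomic n)"
      using assms primitive_root_power_neq_minus_1[of _ n j] odd_pos[OF assms]
      by (intro coprime_cyclotomic) (auto simp: c_poly_add c_poly_1 map_poly_monom poly_monom)
  qed
qed

section \<open>The congruence for the numerator and for the double sum\<close>

text \<open>The congruence rests on
  \<open>(1 - a)\<^sup>2 - (1 - a / y) * (1 - a * y) = a * (1 - y)\<^sup>2 / y\<close> with \<open>y = q\<^sup>n\<close>.\<close>

lemma qpochhammer_square_cong:
  fixes m :: nat
  defines "n \<equiv> 2 * m + 1" and "q \<equiv> q_indet" and "Q \<equiv> q_indet\<^sup>2"
  shows "ratfun_cong ((qpochhammer q Q k)\<^sup>2)
           (qpochhammer (inverse (Q ^ m)) Q k * qpochhammer (Q ^ Suc m) Q k) ((cyclotomic n)\<^sup>2)"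
proof -
  define R where "R = coprime_fracs ((cyclotomic n)\<^sup>2)"
  have n: "n > 0" by (simp add: n_def)
  have q: "q \<in> R" "inverse q \<in> R" "q \<noteq> 0"
    using inverse_q_indet_in_coprime_fracs[OF n] q_indet_nonzero
    by (auto simp: q_def R_def) (auto simp: q_indet_def)
  have Q: "Q \<in> R" "inverse Q \<in> R" "Q \<noteq> 0"
    using q by (auto simp: q_def[symmetric] Q_def R_def power2_eq_square)
  obtain s where "monom 1 n - 1 = cyclotomic n * s"
    using cyclotomic_dvd[OF n] by (elim dvdE)
  \<comment> \<open>The square of this multiple of \<open>cyclotomic n\<close> will supply the
    modulus.\<close>
  hence s: "q ^ n - 1 = to_fract (cyclotomic n) * to_fract s"
    by (simp add: q_def q_indet_power flip: to_fract_mult to_fract_1 to_fract_diff)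
  have "ratfun_cong (\<Prod>i<k. (1 - q * Q ^ i)\<^sup>2)
      (\<Prod>i<k. (1 - inverse (Q ^ m) * Q ^ i) * (1 - Q ^ Suc m * Q ^ i)) ((cyclotomic n)\<^sup>2)"
  proof (rule ratfun_cong_prod)
    fix i
    define a where "a = q * Q ^ i"
    define y where "y = q ^ n"
    have y: "y \<noteq> 0" using q by (simp add: y_def)
    \<comment> \<open>Because \<open>n = 2 * m + 1\<close>, the exponents \<open>1 - n\<close> and
      \<open>1 + n\<close> of \<open>q\<close> are even and give the powers \<open>-m\<close> and
      \<open>m + 1\<close> of \<open>Q\<close>.\<close>
    have "q * inverse y = inverse (Q ^ m)"
      using q by (simp add: y_def n_def Q_def q_def[symmetric] power_mult)
    hence 1: "inverse (Q ^ m) * Q ^ i = a * inverse y" by (simp add: a_def mult_ac)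
    have "q * y = Q ^ Suc m"
      by (simp add: y_def n_def Q_def q_def[symmetric] power_mult power2_eq_square)
    hence 2: "Q ^ Suc m * Q ^ i = a * y" by (metis a_def mult.assoc mult.commute)
    have "(1 - a)\<^sup>2 - (1 - a * inverse y) * (1 - a * y) = (y - 1)\<^sup>2 * (a * inverse y)"
      using y by (simp add: field_simps power2_eq_square)
    also have "\<dots> = to_fract ((cyclotomic n)\<^sup>2) * ((to_fract s)\<^sup>2 * (a * inverse y))"
      by (simp add: y_def s power2_eq_square mult_ac)
    finally have eq: "(1 - a)\<^sup>2 - (1 - a * inverse y) * (1 - a * y)
      = to_fract ((cyclotomic n)\<^sup>2) * ((to_fract s)\<^sup>2 * (a * inverse y))" .
    have aR: "a \<in> R" using q Q by (auto simp: a_def R_def)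
    have yR: "y \<in> R" using q by (auto simp: y_def R_def)
    have "inverse q ^ n \<in> R" using q unfolding R_def by (intro coprime_fracs_power)
    hence yR': "inverse y \<in> R" by (simp add: y_def power_inverse)
    have "(to_fract s)\<^sup>2 * (a * inverse y) \<in> R"
      using aR yR' unfolding R_def
      by (intro coprime_fracs_mult coprime_fracs_power coprime_fracs_to_fract)
    thus "ratfun_cong ((1 - q * Q ^ i)\<^sup>2)
        ((1 - inverse (Q ^ m) * Q ^ i) * (1 - Q ^ Suc m * Q ^ i)) ((cyclotomic n)\<^sup>2)"
      unfolding ratfun_cong_altdef 1 2 a_def[symmetric] R_def using eq by blast
    show "(1 - q * Q ^ i)\<^sup>2 \<in> coprime_fracs ((cyclotomic n)\<^sup>2)"
      using aR unfolding a_def[symmetric] R_def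
      by (intro coprime_fracs_power coprime_fracs_diff coprime_fracs_1)
    show "(1 - inverse (Q ^ m) * Q ^ i) * (1 - Q ^ Suc m * Q ^ i)
        \<in> coprime_fracs ((cyclotomic n)\<^sup>2)"
      using aR yR yR' unfolding 1 2 R_def
      by (intro coprime_fracs_mult coprime_fracs_diff coprime_fracs_1)
  qed
  thus ?thesis by (simp only: qpochhammer_def prod_power_distrib prod.distrib)
qed

theorem theorem5p1:
  fixes n :: nat
  assumes "n > 0" and "odd n"
  shows "ratfun_cong (\<Sum>k=0..n-1. \<Sum>j=0..k. c_q q_indet j * c_q q_indet (k - j)) 1
           ((cyclotomic n)\<^sup>2)"
proof -
  obtain m where n: "n = 2 * m + 1" using \<open>odd n\<close> by (elim oddE)
  define q where "q = q_indet"
  define Q where "Q = q_indet\<^sup>2"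
  define P where "P = (cyclotomic n)\<^sup>2"
  define R where "R = coprime_fracs P"
  \<comment> \<open>\<open>N\<close> is the substitute for the squared numerator factorial, and
    \<open>w\<close> collects all remaining factors of \<open>c_q\<close>. Writing \<open>w\<close>
    with inverses lets membership in \<open>R\<close> be checked factor by factor.\<close>
  define N where "N = (\<lambda>k. qpochhammer (inverse (Q ^ m)) Q k * qpochhammer (Q ^ Suc m) Q k)"
  define w where "w = (\<lambda>k. 2 * Q ^ k * ((inverse (qpochhammer Q Q k))\<^sup>2 * inverse (1 + Q ^ k)))"
  define d where "d = (\<lambda>k. N k * w k)"
  have R: "R = coprime_fracs (cyclotomic n)" by (simp add: R_def P_def)
  have Q: "Q ^ k = q_indet ^ (2 * k)" for k by (simp add: Q_def power_mult)
  have Q0: "Q \<noteq> 0" by (simp add: Q_def q_indet_nonzero)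
  have Q1: "Q ^ Suc k \<noteq> 1" for k unfolding Q by (rule q_indet_power_neq_1) simp
  have Q2: "1 + Q ^ k \<noteq> 0" for k unfolding Q by (rule one_plus_q_indet_power_nonzero)
  have QR: "Q \<in> R" "inverse Q \<in> R"
    using inverse_q_indet_in_coprime_fracs[OF \<open>n > 0\<close>] unfolding R Q_def
    by (auto simp: power2_eq_square) (auto simp: q_indet_def)
  have c: "c_q q k = (qpochhammer q Q k)\<^sup>2 * w k" for k
    unfolding w_def Q by (simp add: c_q_def q_def field_simps flip: Q_def)
  \<comment> \<open>The bound keeps \<open>1 - Q^n\<close>, a multiple of
    \<open>cyclotomic n\<close>, out of the denominator.\<close>
  have wR: "w k \<in> R" if "k < n" for k
  proof -
    have "inverse (qpochhammer Q Q k) = (\<Prod>i<k. inverse (1 - q_indet ^ (2 * Suc i)))"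
      unfolding Q[symmetric] by (simp add: qpochhammer_def flip: prod_inversef)
    also have "\<dots> \<in> R"
      unfolding R using that \<open>odd n\<close>
      by (intro coprime_fracs_prod inverse_one_minus_in_coprime_fracs) auto
    finally have 1: "inverse (qpochhammer Q Q k) \<in> R" .
    have 2: "inverse (1 + Q ^ k) \<in> R"
      using inverse_one_plus_in_coprime_fracs[OF \<open>odd n\<close>, of "2 * k"]
      by (simp add: R Q_def power_mult)
    have "1 + 1 \<in> R" unfolding R by blast
    thus ?thesis unfolding w_def using 1 2 QR unfolding R
      by (intro coprime_fracs_mult coprime_fracs_power) auto
  qed
  have NR: "N k \<in> R" for k
  proof -
    have "inverse Q ^ m \<in> R" using QR unfolding R by blast
    hence "inverse (Q ^ m) \<in> R" by (simp add: power_inverse)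
    thus ?thesis unfolding N_def qpochhammer_def using QR unfolding R
      by (intro coprime_fracs_mult coprime_fracs_prod coprime_fracs_diff
          coprime_fracs_1 coprime_fracs_power)
  qed
  have qR: "qpochhammer q Q k \<in> R" for k
    unfolding qpochhammer_def using QR unfolding R q_def
    by (intro coprime_fracs_mult coprime_fracs_prod coprime_fracs_diff
          coprime_fracs_1 coprime_fracs_power) (auto simp: q_indet_def)
  have cR: "c_q q k \<in> R" if "k < n" for k
    unfolding c using qR wR[OF that] unfolding R by blast
  have dR: "d k \<in> R" if "k < n" for k
    unfolding d_def using NR wR[OF that] unfolding R by blast
  have cd: "ratfun_cong (c_q q k) (d k) P" if "k < n" for k
    unfolding c d_def
  proof (rule ratfun_cong_mult)
    show "ratfun_cong ((qpochhammer q Q k)\<^sup>2) (N k) P"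
      unfolding N_def P_def q_def Q_def n by (rule qpochhammer_square_cong)
  qed (use NR wR[OF that] in \<open>auto simp: R_def\<close>)
  have "ratfun_cong (\<Sum>k=0..n-1. \<Sum>j=0..k. c_q q j * c_q q (k - j))
      (\<Sum>k=0..n-1. \<Sum>j=0..k. d j * d (k - j)) P"
    \<comment> \<open>Both \<open>j\<close> and \<open>k - j\<close> are at most
      \<open>n - 1\<close>, so every factor stays within the range of \<open>cd\<close>,
      \<open>cR\<close> and \<open>dR\<close>.\<close>
    by (intro ratfun_cong_sum ratfun_cong_mult)
       (use cd cR dR \<open>n > 0\<close> in \<open>auto simp: R_def\<close>)
  \<comment> \<open>The truncation point \<open>n - 1\<close> equals \<open>2 * m\<close>, twice the
    last index at which \<open>d\<close> can be nonzero, so no product of nonzero terms is cut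
    off.\<close>
  also have "(\<Sum>k=0..n-1. \<Sum>j=0..k. d j * d (k - j)) = (\<Sum>k\<le>2*m. \<Sum>j\<le>k. d j * d (k - j))"
    by (simp add: n atLeast0AtMost)
  also have "\<dots> = (\<Sum>j\<le>m. d j)\<^sup>2"
  proof (rule sum_convolution_square)
    fix j assume "m < j"
    hence "qpochhammer (inverse (Q ^ m)) Q j = 0"
      using Q0 by (intro qpochhammer_eq_0[of m]) auto
    thus "d j = 0" by (simp add: d_def N_def)
  qed
  also have "(\<Sum>j\<le>m. d j) = (-1) ^ m"
    using sum_qpochhammer_saalschuetz[OF Q0 Q1 Q2, of m]
    by (simp add: d_def N_def w_def field_simps)
  \<comment> \<open>Squaring removes the dependence on the parity of \<open>m\<close>.\<close>
  also have "((-1) ^ m)\<^sup>2 = (1 :: rat poly fract)"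
    by (simp flip: power_mult)
  finally show ?thesis by (simp only: q_def P_def)
qed

end
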